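(* Let $G$ be a finite simple graph with order $n$, girth $g$ (with $3\le g<\infty$), minimum degree $\delta\ge 2$ and equator $q$, and let $k=\lceil g/2\rceil-1$. If $q>6k+3$, then \[ n\ \ge\ \frac{q}{g}\,M(\delta,g). \]
   Context: The girth is the length of a shortest cycle. A cycle $C$ in $G$ is isometric if $d_C(x,y)=d_G(x,y)$ for all vertices $x,y$ of $C$. The equator of $G$ is the length of a longest isometric cycle of $G$. The Moore bound is defined for integers $\delta\ge 2$, $g\ge 3$, with $k=\lceil g/2\rceil-1$, by $M(\delta,g)=1+\sum_{i=0}^{k-1}\delta(\delta-1)^i$ if $g$ is odd and $M(\delta,g)=2+\sum_{i=1}^{k}2(\delta-1)^i$ if $g$ is even. *)

theory Defs
  imports "Graph_Theory.Graph_Theory" "HOL-Library.Extended_Nat"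
begin

text \<open>
  A finite simple graph is a \<^locale>\<open>pair_graph\<close>: each edge \<open>uv\<close> is
  represented by the two arcs \<open>(u, v)\<close> and \<open>(v, u)\<close>.
\<close>

text \<open>
  In a symmetric digraph the arc list \<open>[(u, v), (v, u)]\<close> satisfies
  \<^const>\<open>pre_digraph.cycle\<close>; the length condition excludes exactly these
  back-and-forth walks along one edge.
\<close>
definition graph_cycle :: "'a pair_pre_digraph \<Rightarrow> ('a \<times> 'a) awalk \<Rightarrow> bool" where
  "graph_cycle G p \<longleftrightarrow> pre_digraph.cycle (with_proj G) p \<and> 3 \<le> length p"

text \<open>The undirected graph formed by the vertices and edges of a walk.\<close>
definition walk_graph :: "('a \<times> 'a) awalk \<Rightarrow> 'a pair_pre_digraph" where
  "walk_graph p = \<lparr> pverts = fst ` set p \<union> snd ` set p, parcs = set p \<union> (set p)\<inverse> \<rparr>"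

text \<open>Hence the distances in \<^term>\<open>walk_graph p\<close> used below are meaningful for all \<open>p\<close>.\<close>
lemma pair_wf_digraph_walk_graph: "pair_wf_digraph (walk_graph p)"
  by unfold_locales (auto simp: walk_graph_def image_iff intro: rev_bexI)

definition graph_dist :: "'a pair_pre_digraph \<Rightarrow> 'a \<Rightarrow> 'a \<Rightarrow> ereal" where
  "graph_dist G x y = wf_digraph.\<mu> (with_proj G) (\<lambda>_. 1) x y"

definition isometric_cycle :: "'a pair_pre_digraph \<Rightarrow> ('a \<times> 'a) awalk \<Rightarrow> bool" where
  "isometric_cycle G p \<longleftrightarrow> graph_cycle G p \<and>
     (\<forall>x \<in> pverts (walk_graph p). \<forall>y \<in> pverts (walk_graph p).
        graph_dist (walk_graph p) x y = graph_dist G x y)"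

text \<open>The girth of an acyclic graph is \<open>\<infinity>\<close>.\<close>
definition girth :: "'a pair_pre_digraph \<Rightarrow> enat" where
  "girth G = (INF p \<in> {p. graph_cycle G p}. enat (length p))"

text \<open>
  In a finite graph that contains a cycle, the set below is finite and, since a
  shortest cycle is isometric, nonempty.
\<close>
definition equator :: "'a pair_pre_digraph \<Rightarrow> nat" where
  "equator G = Max {length p | p. isometric_cycle G p}"

definition min_degree :: "'a pair_pre_digraph \<Rightarrow> nat" where
  "min_degree G = Min (out_degree (with_proj G) ` pverts G)"

definition half_girth :: "nat \<Rightarrow> nat" where
  "half_girth g = nat (\<lceil>real g / 2\<rceil> - 1)"

text \<open>The Moore bound, meant for \<open>\<delta> \<ge> 2\<close> and \<open>g \<ge> 3\<close>.\<close>
definition moore_bound :: "nat \<Rightarrow> nat \<Rightarrow> nat" where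
  "moore_bound \<delta> g =
     (if odd g then 1 + (\<Sum>i<half_girth g. \<delta> * (\<delta> - 1) ^ i)
      else 2 + (\<Sum>i = 1..half_girth g. 2 * (\<delta> - 1) ^ i))"

end

theory Submission
  imports Defs
begin

text \<open>
  Let \<open>C\<close> be a longest isometric cycle. A closed walk that never backtracks contains a cycle, so
  nonbacktracking walks with the same ends and total length below the girth coincide; hence the ball
  of radius \<open>k\<close> around a vertex (\<open>g\<close> odd) or an edge (\<open>g\<close> even) of \<open>C\<close> has at least
  \<open>M(\<delta>, g)\<close> vertices. Vertices of \<open>C\<close> within distance \<open>k\<close> of a given vertex of \<open>G\<close> are pairwise at
  distance at most \<open>2k\<close>, along \<open>C\<close> since \<open>C\<close> is isometric. As \<open>q > 6k\<close>, they lie on an arc of at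
  most \<open>2k + 1\<close> vertices, so each vertex of \<open>G\<close> is in at most \<open>g\<close> of the \<open>q\<close> balls. Count the
  incidences.
\<close>

section \<open>Nonbacktracking walks\<close>

text \<open>Consecutive arcs \<open>e\<close>, \<open>f\<close> of a walk satisfy
  \<open>snd e = fst f\<close>, so the condition says that \<open>f\<close> is not the reverse of
  \<open>e\<close>. In a closed walk the junction of the last arc with the first is left
  free.\<close>

definition nonbacktracking :: "('a \<times> 'a) awalk \<Rightarrow> bool" where
  "nonbacktracking = successively (\<lambda>e f. fst e \<noteq> snd f)"

lemma nonbacktracking_simps [simp]:
  "nonbacktracking []"
  "nonbacktracking [e]"
  "nonbacktracking (e # p) \<longleftrightarrow> nonbacktracking p \<and> (p = [] \<or> fst e \<noteq> snd (hd p))"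
  by (auto simp: nonbacktracking_def successively_Cons)

lemma nonbacktracking_append [simp]:
  "nonbacktracking (p @ q) \<longleftrightarrow> nonbacktracking p \<and> nonbacktracking q \<and>
     (p = [] \<or> q = [] \<or> fst (last p) \<noteq> snd (hd q))"
  by (auto simp: nonbacktracking_def successively_append_iff)

lemma length_rev_path [simp]: "length (rev_path p) = length p"
  by (induction p) auto

lemma last_rev_path: "p \<noteq> [] \<Longrightarrow> last (rev_path p) = (snd (hd p), fst (hd p))"
  by (cases p) auto

lemma hd_rev_path: "p \<noteq> [] \<Longrightarrow> hd (rev_path p) = (snd (last p), fst (last p))"
  by (induction p) (auto simp: hd_append)

lemma nonbacktracking_rev_path [simp]: "nonbacktracking (rev_path p) = nonbacktracking p"
  by (induction p) (auto simp: last_rev_path)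

text \<open>Arcs are prepended one at a time to a reduced tail: a new arc either extends it or
  cancels against its first arc. The locale \<open>pair_wf_digraph\<close> makes this available in
  \<open>walk_graph p\<close> too.\<close>

lemma (in pair_wf_digraph) awalk_imp_nonbacktracking:
  assumes "awalk u p v"
  shows "\<exists>p'. awalk u p' v \<and> nonbacktracking p' \<and> length p' \<le> length p"
  using assms
proof (induction p arbitrary: u)
  case Nil
  then show ?case by (intro exI[of _ "[]"]) auto
next
  case (Cons e p)
  then obtain p' where p': "awalk (snd e) p' v" "nonbacktracking p'" "length p' \<le> length p"
    by (force simp: awalk_Cons_iff)
  show ?case
  proof (cases "p' = [] \<or> fst e \<noteq> snd (hd p')")
    case True
    with p' Cons.prems show ?thesis
      by (intro exI[of _ "e # p'"]) (auto simp: awalk_Cons_iff)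
  next
    case False
    then obtain f p'' where "p' = f # p''" "snd f = fst e" by (cases p') auto
    with p' Cons.prems show ?thesis
      by (intro exI[of _ p'']) (auto simp: awalk_Cons_iff)
  qed
qed

lemma (in pair_wf_digraph) awalk_nth:
  "awalk u p v \<Longrightarrow> Suc j < length p \<Longrightarrow> snd (p ! j) = fst (p ! Suc j)"
proof (induction p arbitrary: u j)
  case (Cons e p)
  then show ?case by (cases j; cases p) (auto simp: awalk_Cons_iff)
qed simp

section \<open>Distance as the least length of a walk\<close>

lemma (in pair_wf_digraph) graph_dist_eq:
  "graph_dist G x y = (INF p\<in>{p. awalk x p y}. ereal (real (length p)))"
  by (simp add: graph_dist_def \<mu>_def awalk_cost_def sum_list_triv)

lemma (in pair_wf_digraph) graph_dist_le_iff:
  "graph_dist G x y \<le> ereal (real m) \<longleftrightarrow> (\<exists>p. awalk x p y \<and> length p \<le> m)"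
proof
  assume "graph_dist G x y \<le> ereal (real m)"
  \<comment> \<open>An infimum yields a witness only below a strict bound; lengths are natural
    numbers, so passing to \<open>Suc m\<close> loses nothing.\<close>
  also have "\<dots> < ereal (real (Suc m))" by simp
  finally obtain p where "awalk x p y" "ereal (real (length p)) < ereal (real (Suc m))"
    unfolding graph_dist_eq INF_less_iff by auto
  then show "\<exists>p. awalk x p y \<and> length p \<le> m" by auto
next
  assume "\<exists>p. awalk x p y \<and> length p \<le> m"
  then show "graph_dist G x y \<le> ereal (real m)"
    unfolding graph_dist_eq by (auto intro: INF_lower2)
qed

section \<open>Positions on a circle, counting, and girth\<close>

text \<open>Integer indices read modulo the length let a position move both ways past the ends of
  the list without case distinctions.\<close>

definition cycle_vertex :: "('a \<times> 'a) awalk \<Rightarrow> int \<Rightarrow> 'a" where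
  "cycle_vertex p i = fst (p ! nat (i mod int (length p)))"

lemma cycle_vertex_cong:
  "i mod int (length p) = j mod int (length p) \<Longrightarrow> cycle_vertex p i = cycle_vertex p j"
  by (simp add: cycle_vertex_def)

text \<open>Three residues modulo \<open>q\<close> that are pairwise at cyclic distance at most \<open>d\<close> cannot wind
  around the circle, since \<open>3 * d < q\<close>.\<close>
lemma pairwise_close_imp_window:
  fixes S :: "int set" and q d :: int
  assumes close: "\<And>i j. i \<in> S \<Longrightarrow> j \<in> S \<Longrightarrow> \<exists>t. \<bar>t\<bar> \<le> d \<and> q dvd j - (i + t)"
    and periodic: "\<And>i j. i \<in> S \<Longrightarrow> q dvd j - i \<Longrightarrow> j \<in> S"
    and "3 * d < q"
  shows "\<exists>a. \<forall>i\<in>S. \<exists>s\<in>{0..d}. q dvd i - (a + s)"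
proof (cases "S = {}")
  case False
  then obtain i0 where i0: "i0 \<in> S" by auto
  \<comment> \<open>\<open>D\<close> collects the offsets from \<open>i0\<close> that stay in
    \<open>S\<close>, confined to \<open>{-d..d}\<close>; the least one marks the left end of the
    window.\<close>
  define D where "D = {t. \<bar>t\<bar> \<le> d \<and> i0 + t \<in> S}"
  have "finite D" by (rule finite_subset[of _ "{-d..d}"]) (auto simp: D_def)
  have shift: "\<exists>t\<in>D. q dvd i - (i0 + t)" if i: "i \<in> S" for i
  proof -
    obtain t where t: "\<bar>t\<bar> \<le> d" "q dvd i - (i0 + t)" using close[OF i0 i] by auto
    have "i0 + t \<in> S" using t(2) by (intro periodic[OF i]) (simp add: dvd_diff_commute)
    with t show ?thesis by (auto simp: D_def)
  qed
  then have "D \<noteq> {}" using i0 by auto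
  define m where "m = Min D"
  have m: "m \<in> D" "\<And>t. t \<in> D \<Longrightarrow> m \<le> t"
    using \<open>finite D\<close> \<open>D \<noteq> {}\<close> by (auto simp: m_def)
  have "\<exists>s\<in>{0..d}. q dvd i - (i0 + m + s)" if "i \<in> S" for i
  proof -
    obtain t where t: "t \<in> D" "q dvd i - (i0 + t)" using shift[OF \<open>i \<in> S\<close>] by auto
    obtain u where u: "\<bar>u\<bar> \<le> d" "q dvd (i0 + t) - (i0 + m + u)"
      using close[of "i0 + m" "i0 + t"] m(1) t(1) by (auto simp: D_def)
    \<comment> \<open>Here \<open>0 \<le> t - m \<le> 2 * d\<close> and
      \<open>\<bar>u\<bar> \<le> d\<close>, so the difference is at most \<open>3 * d\<close> in
      absolute value. Being a multiple of \<open>q\<close>, it vanishes, and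
      \<open>t - m = u \<le> d\<close>.\<close>
    have "\<bar>t - m - u\<bar> < q"
      using m(1) m(2)[OF t(1)] t(1) u(1) \<open>3 * d < q\<close> by (auto simp: D_def)
    moreover have "q dvd t - m - u" using u(2) by (simp add: algebra_simps)
    ultimately have "t - m - u = 0"
      using dvd_imp_le_int[of "t - m - u" q] by (cases "t - m - u = 0") auto
    then show ?thesis
      using t(2) m(2)[OF t(1)] u(1) by (intro bexI[of _ "t - m"]) auto
  qed
  then show ?thesis by blast
qed auto

text \<open>Elements of \<open>{0..<q}\<close> are their own residues, so each is determined by its
  offset \<open>s\<close>.\<close>

lemma card_window_le:
  fixes T :: "int set" and q a b c :: int
  assumes "T \<subseteq> {0..<q}" and window: "\<And>i. i \<in> T \<Longrightarrow> \<exists>s\<in>{b..c}. q dvd i - (a + s)"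
  shows "card T \<le> nat (c - b + 1)"
proof -
  have "T \<subseteq> (\<lambda>s. (a + s) mod q) ` {b..c}"
  proof
    fix i assume "i \<in> T"
    then obtain s where s: "s \<in> {b..c}" "q dvd i - (a + s)" using window by blast
    have "i = i mod q" using \<open>i \<in> T\<close> assms(1) by auto
    also have "\<dots> = (a + s) mod q" using s(2) by (simp add: mod_eq_dvd_iff)
    finally show "i \<in> (\<lambda>s. (a + s) mod q) ` {b..c}" using s(1) by auto
  qed
  then have "card T \<le> card ((\<lambda>s. (a + s) mod q) ` {b..c})" by (intro card_mono) auto
  also have "\<dots> \<le> card {b..c}" by (rule card_image_le) simp
  finally show ?thesis by simp
qed

text \<open>The number of pairs \<open>(i, v)\<close> with \<open>v \<in> B i\<close> lies between
  the two sides.\<close>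

lemma double_counting_le:
  assumes "finite I" "finite V" "\<And>i. i \<in> I \<Longrightarrow> B i \<subseteq> V"
    and "\<And>i. i \<in> I \<Longrightarrow> M \<le> card (B i)"
    and "\<And>v. v \<in> V \<Longrightarrow> card {i \<in> I. v \<in> B i} \<le> g"
  shows "card I * M \<le> card V * g"
proof -
  have "card I * M = (\<Sum>i\<in>I. M)" by simp
  also have "\<dots> \<le> (\<Sum>i\<in>I. card {v \<in> V. v \<in> B i})"
  proof (rule sum_mono)
    fix i assume i: "i \<in> I"
    then have "{v \<in> V. v \<in> B i} = B i" using assms(3) by auto
    then show "M \<le> card {v \<in> V. v \<in> B i}" using assms(4)[OF i] by simp
  qed
  also have "\<dots> = (\<Sum>v\<in>V. card {i \<in> I. v \<in> B i})"
    unfolding card_eq_sum by (rule sum.swap_restrict[OF assms(1,2)])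
  also have "\<dots> \<le> (\<Sum>v\<in>V. g)" by (rule sum_mono) (rule assms(5))
  finally show ?thesis by simp
qed

lemma half_girth_cases:
  assumes "g \<ge> 1"
  shows "odd g \<Longrightarrow> g = 2 * half_girth g + 1" "even g \<Longrightarrow> g = 2 * half_girth g + 2"
proof -
  assume "odd g"
  then obtain m where m: "g = 2 * m + 1" by (auto elim: oddE)
  have "\<lceil>real g / 2\<rceil> = int m + 1" by (rule ceiling_unique) (auto simp: m field_simps)
  then show "g = 2 * half_girth g + 1" by (simp add: half_girth_def m)
next
  assume "even g"
  then obtain m where m: "g = 2 * m" by (auto elim: evenE)
  have "\<lceil>real g / 2\<rceil> = int m" by (simp add: m)
  then show "g = 2 * half_girth g + 2" using assms m by (simp add: half_girth_def)
qed

text \<open>A finite value rules out the empty infimum, and a nonempty set of \<open>enat\<close>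
  contains its infimum.\<close>

lemma girth_eq_enatD:
  assumes "girth G = enat g"
  shows "\<exists>p. graph_cycle G p \<and> length p = g" and "graph_cycle G c \<Longrightarrow> g \<le> length c"
proof -
  let ?L = "(\<lambda>p. enat (length p)) ` {p. graph_cycle G p}"
  have "?L \<noteq> {}"
  proof
    assume "?L = {}"
    then have "girth G = \<infinity>" unfolding girth_def by (simp only: Inf_empty top_enat_def)
    then show False using assms by simp
  qed
  then have "Inf ?L \<in> ?L" unfolding Inf_enat_def by (auto intro: LeastI)
  then show "\<exists>p. graph_cycle G p \<and> length p = g" using assms by (auto simp: girth_def)
  show "g \<le> length c" if "graph_cycle G c"
  proof -
    have "girth G \<le> enat (length c)" unfolding girth_def using that by (intro INF_lower) auto
    then show ?thesis using assms by simp
  qed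
qed

context pair_graph
begin

section \<open>Uniqueness of short nonbacktracking walks\<close>

lemma map_snd_eq_tl_awalk_verts:
  "awalk u p v \<Longrightarrow> tl (awalk_verts u p) = map snd p"
  by (cases "p = []") (auto simp: awalk_verts_conv' awalk_def)

lemma graph_cycle_altdef:
  "graph_cycle G p \<longleftrightarrow> (\<exists>u. awalk u p u) \<and> distinct (map snd p) \<and> 3 \<le> length p"
  unfolding graph_cycle_def cycle_def
  by (auto simp: map_snd_eq_tl_awalk_verts)

text \<open>If the heads of the arcs are distinct, \<open>p\<close> itself is a cycle: length 1
  would be a loop and length 2 a backtrack. Otherwise the segment after one arc, up to and including
  another with the same head, is a shorter closed nonbacktracking walk.\<close>

lemma closed_nonbacktracking_imp_cycle:
  assumes "awalk u p u" "nonbacktracking p" "p \<noteq> []"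
  shows "\<exists>c. graph_cycle G c \<and> length c \<le> length p"
  using assms
proof (induction "length p" arbitrary: u p rule: less_induct)
  case less
  show ?case
  proof (cases "distinct (map snd p)")
    case True
    have "length p \<noteq> 1"
      using less.prems by (auto simp: length_Suc_conv awalk_Cons_iff awalk_Nil_iff dest: no_loops')
    moreover have "length p \<noteq> 2"
      using less.prems by (auto simp: length_Suc_conv eval_nat_numeral awalk_Cons_iff awalk_Nil_iff)
    moreover have "length p \<noteq> 0" using less.prems by simp
    ultimately have "length p \<ge> 3" by linarith
    with True less.prems show ?thesis by (auto simp: graph_cycle_altdef)
  next
    case False
    then obtain as e bs f cs where p: "p = as @ e # bs @ f # cs" "snd e = snd f"
      using not_distinct_decomp[OF False]
      by (auto simp: map_eq_append_conv append_eq_map_conv Cons_eq_map_conv map_eq_Cons_conv)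
    have "awalk (snd e) (bs @ [f]) (snd e)"
      using less.prems(1) p by (auto simp: awalk_Cons_iff awalk_Nil_iff in_arcsD2)
    moreover have "nonbacktracking (bs @ [f])"
      using less.prems(2) p by (auto simp: hd_append)
    ultimately obtain c where "graph_cycle G c" "length c \<le> length (bs @ [f])"
      using less.hyps[of "bs @ [f]"] p by auto
    then show ?thesis using p by auto
  qed
qed

text \<open>Equal last arcs are stripped off. If the last arcs differ, going along one walk and back
  along the other is closed and nonbacktracking, hence contains a cycle that is too short.\<close>

lemma nonbacktracking_unique:
  assumes girth: "\<And>c. graph_cycle G c \<Longrightarrow> length p + length q < length c"
    and "awalk u p v" "nonbacktracking p" "awalk u q v" "nonbacktracking q"
  shows "p = q"
  using assms
proof (induction p arbitrary: q v rule: rev_induct)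
  case Nil
  then have "awalk u q u" by (auto simp: awalk_Nil_iff)
  then show ?case using closed_nonbacktracking_imp_cycle[of u q] Nil by force
next
  case (snoc e p)
  show ?case
  proof (cases q rule: rev_cases)
    case Nil
    then have "awalk u (p @ [e]) u" using snoc.prems by (auto simp: awalk_Nil_iff)
    then show ?thesis using closed_nonbacktracking_imp_cycle[of u "p @ [e]"] snoc.prems Nil
      by (force simp del: awalk_append_iff)
  next
    case (snoc q' f)
    note q = this
    have ends: "snd e = v" "snd f = v" "awalk u p (fst e)" "awalk u q' (fst f)"
      using snoc.prems q by (auto simp: awalk_Cons_iff awalk_Nil_iff)
    show ?thesis
    proof (cases "fst e = fst f")
      case True
      have "p = q'"
      proof (rule snoc.IH)
        show "length p + length q' < length c" if "graph_cycle G c" for c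
          using snoc.prems(1)[OF that] q by simp
      qed (use snoc.prems q ends True in auto)
      then show ?thesis using q True ends by (simp add: prod_eq_iff)
    next
      case False
      \<comment> \<open>The last arcs of both walks end at \<open>v\<close> but start at different
        vertices, so the turn at \<open>v\<close> is not a backtrack.\<close>
      let ?w = "(p @ [e]) @ rev_path q"
      have "awalk u ?w u"
        by (rule awalk_appendI[of _ _ v]) (use snoc.prems in \<open>auto simp del: awalk_append_iff\<close>)
      moreover have "nonbacktracking (rev_path q)" "hd (rev_path q) = (snd f, fst f)"
        using snoc.prems(5) q by (simp_all only: nonbacktracking_rev_path) (simp add: hd_rev_path)
      then have "nonbacktracking ?w"
        unfolding nonbacktracking_append[of "p @ [e]"] using snoc.prems(3) False by simp
      ultimately obtain c where "graph_cycle G c" "length c \<le> length ?w"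
        using closed_nonbacktracking_imp_cycle[of u ?w] by auto
      then show ?thesis using snoc.prems(1)[of c] by simp
    qed
  qed
qed

lemma awlast_eq: "p \<noteq> [] \<Longrightarrow> awlast u p = snd (last p)"
  by (simp add: awalk_verts_conv)

section \<open>Counting nonbacktracking walks\<close>

text \<open>Fixing the first arc makes the branching uniform: each of the \<open>l\<close> arcs
  after it has at least \<open>\<delta> - 1\<close> choices when all degrees are at least
  \<open>\<delta>\<close>.\<close>

definition nb_walks_from :: "'a \<times> 'a \<Rightarrow> nat \<Rightarrow> ('a \<times> 'a) awalk set" where
  "nb_walks_from e l =
     {p. p \<noteq> [] \<and> hd p = e \<and> length p = Suc l \<and> nonbacktracking p \<and> awalk (fst e) p (snd (last p))}"

lemma finite_nb_walks_from: "finite (nb_walks_from e l)"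
proof (rule finite_subset)
  show "nb_walks_from e l \<subseteq> {p. set p \<subseteq> parcs G \<and> length p = Suc l}"
    by (auto simp: nb_walks_from_def)
qed (simp add: finite_lists_length_eq pair_finite_arcs)

text \<open>A walk can be extended by every arc leaving its end except the reverse of its last arc,
  and extensions of different walks differ.\<close>

lemma card_nb_walks_from_ge:
  assumes deg: "\<And>v. v \<in> pverts G \<Longrightarrow> \<delta> \<le> out_degree G v" and e: "e \<in> parcs G"
  shows "(\<delta> - 1) ^ l \<le> card (nb_walks_from e l)"
proof (induction l)
  case 0
  have "{[e]} \<subseteq> nb_walks_from e 0"
    using e by (auto simp: nb_walks_from_def awalk_Cons_iff awalk_Nil_iff in_arcsD2)
  from card_mono[OF finite_nb_walks_from this] show ?case by simp
next
  case (Suc l)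
  define X where "X p = out_arcs G (snd (last p)) - {(snd (last p), fst (last p))}"
    for p :: "('a \<times> 'a) awalk"
  have X: "\<delta> - 1 \<le> card (X p)" "finite (X p)" if "p \<in> nb_walks_from e l" for p
  proof -
    have "snd (last p) \<in> pverts G" using that by (auto simp: nb_walks_from_def)
    from deg[OF this] show "\<delta> - 1 \<le> card (X p)"
      using diff_card_le_card_Diff[of "{(snd (last p), fst (last p))}" "out_arcs G (snd (last p))"]
      unfolding X_def out_degree_def by simp
    show "finite (X p)" by (auto simp: X_def)
  qed
  have "(\<delta> - 1) ^ Suc l \<le> (\<Sum>p\<in>nb_walks_from e l. \<delta> - 1)"
    using Suc.IH by (simp add: mult.commute)
  also have "\<dots> \<le> (\<Sum>p\<in>nb_walks_from e l. card ((\<lambda>f. p @ [f]) ` X p))"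
    using X by (intro sum_mono) (simp add: card_image inj_on_def)
  also have "\<dots> = card (\<Union>p\<in>nb_walks_from e l. (\<lambda>f. p @ [f]) ` X p)"
    by (rule card_UN_disjoint[symmetric]) (auto simp: finite_nb_walks_from X)
  also have "\<dots> \<le> card (nb_walks_from e (Suc l))"
    by (rule card_mono[OF finite_nb_walks_from])
       (auto simp: nb_walks_from_def X_def awalk_Cons_iff awalk_Nil_iff awlast_eq in_arcsD2)
  finally show ?case .
qed

text \<open>The lengths run from 1 to \<open>m\<close>; the empty walk is absent and has to be added
  where it counts.\<close>

definition nb_walks :: "('a \<times> 'a) set \<Rightarrow> nat \<Rightarrow> ('a \<times> 'a) awalk set" where
  "nb_walks A m = (\<Union>(e, l)\<in>A \<times> {..<m}. nb_walks_from e l)"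

lemma nb_walksD:
  assumes "p \<in> nb_walks A m"
  shows "p \<noteq> []" "hd p \<in> A" "length p \<le> m" "nonbacktracking p"
    "awalk (fst (hd p)) p (snd (last p))"
  using assms by (auto simp: nb_walks_def nb_walks_from_def)

lemma finite_nb_walks: "A \<subseteq> parcs G \<Longrightarrow> finite (nb_walks A m)"
  using finite_subset[OF _ pair_finite_arcs] by (auto simp: nb_walks_def finite_nb_walks_from)

text \<open>A walk determines its first arc and its length, so the union is disjoint.\<close>

lemma card_nb_walks_ge:
  assumes "\<And>v. v \<in> pverts G \<Longrightarrow> \<delta> \<le> out_degree G v" "A \<subseteq> parcs G"
  shows "card A * (\<Sum>l<m. (\<delta> - 1) ^ l) \<le> card (nb_walks A m)"
proof -
  have "finite A" using assms(2) pair_finite_arcs by (rule finite_subset)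
  have "card A * (\<Sum>l<m. (\<delta> - 1) ^ l) = (\<Sum>(e, l)\<in>A \<times> {..<m}. (\<delta> - 1) ^ l)"
    by (simp flip: sum.cartesian_product)
  also have "\<dots> \<le> (\<Sum>(e, l)\<in>A \<times> {..<m}. card (nb_walks_from e l))"
  proof (intro sum_mono, clarify)
    fix a b l assume "(a, b) \<in> A"
    then have ab: "(a, b) \<in> parcs G" using assms(2) by blast
    show "(\<delta> - 1) ^ l \<le> card (nb_walks_from (a, b) l)"
      by (rule card_nb_walks_from_ge[OF assms(1) ab])
  qed
  also have "\<dots> = card (nb_walks A m)"
    unfolding nb_walks_def case_prod_unfold
    by (rule card_UN_disjoint[symmetric])
       (use \<open>finite A\<close> in \<open>auto simp: finite_nb_walks_from\<close>, auto simp: nb_walks_from_def)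
  finally show ?thesis .
qed

section \<open>Moore bounds for balls around vertices and edges\<close>

text \<open>By \<open>graph_dist_le_iff\<close> this is the closed ball of radius \<open>m\<close>;
  walks are the form in which it is counted and in which paths are concatenated.\<close>

definition walk_ball :: "'a \<Rightarrow> nat \<Rightarrow> 'a set" where
  "walk_ball x m = {v. \<exists>p. awalk x p v \<and> length p \<le> m}"

lemma walk_ball_subset: "walk_ball x m \<subseteq> pverts G"
  by (auto simp: walk_ball_def)

lemma finite_walk_ball: "finite (walk_ball x m)"
  using walk_ball_subset pair_finite_verts by (rule finite_subset)

text \<open>Two nonbacktracking walks of length at most \<open>k\<close> from \<open>x\<close> have
  total length at most \<open>2 * k\<close>, so distinct walks have distinct ends. The left side is
  the Moore bound for girth \<open>2 * k + 1\<close>; its 1 comes from the empty walk.\<close>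

lemma card_walk_ball_ge:
  assumes deg: "\<And>v. v \<in> pverts G \<Longrightarrow> \<delta> \<le> out_degree G v"
    and girth: "\<And>c. graph_cycle G c \<Longrightarrow> 2 * k < length c" and x: "x \<in> pverts G"
  shows "1 + \<delta> * (\<Sum>l<k. (\<delta> - 1) ^ l) \<le> card (walk_ball x k)"
proof -
  let ?P = "insert [] (nb_walks (out_arcs G x) k)"
  have sub: "out_arcs G x \<subseteq> parcs G" by auto
  have P: "awalk x p (awlast x p)" "nonbacktracking p" "length p \<le> k" if "p \<in> ?P" for p
    using that nb_walksD[of p "out_arcs G x" k] x by (auto simp: awalk_Nil_iff awlast_eq)
  have "1 + \<delta> * (\<Sum>l<k. (\<delta> - 1) ^ l) \<le> 1 + card (out_arcs G x) * (\<Sum>l<k. (\<delta> - 1) ^ l)"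
    using deg[OF x] by (simp add: out_degree_def)
  also have "\<dots> \<le> 1 + card (nb_walks (out_arcs G x) k)"
    using card_nb_walks_ge[OF deg sub] by simp
  also have "\<dots> = card ?P"
    using finite_nb_walks[OF sub] nb_walksD(1) by (subst card_insert_disjoint) auto
  also have "\<dots> = card (awlast x ` ?P)"
  proof (rule card_image[symmetric], rule inj_onI)
    fix p q assume *: "p \<in> ?P" "q \<in> ?P" "awlast x p = awlast x q"
    show "p = q"
    proof (rule nonbacktracking_unique[of p q x])
      show "length p + length q < length c" if "graph_cycle G c" for c
        using girth[OF that] P(3)[OF *(1)] P(3)[OF *(2)] by simp
      show "awalk x p (awlast x p)" "awalk x q (awlast x p)"
        using P(1)[OF *(1)] P(1)[OF *(2)] *(3) by simp_all
    qed (use P(2) * in auto)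
  qed
  also have "\<dots> \<le> card (walk_ball x k)"
  proof (rule card_mono[OF finite_walk_ball], rule image_subsetI)
    show "awlast x p \<in> walk_ball x k" if "p \<in> ?P" for p
      using P(1,3)[OF that] unfolding walk_ball_def by blast
  qed
  finally show ?thesis .
qed

text \<open>The left side is the Moore bound for girth \<open>2 * k + 2\<close>. It counts
  nonbacktracking walks of 1 to \<open>k + 1\<close> arcs that begin along the edge in either
  direction. Without its first arc such a walk stays within \<open>k\<close> of \<open>x\<close> or
  \<open>y\<close>, and distinct walks have distinct ends.\<close>

lemma card_edge_ball_ge:
  assumes deg: "\<And>v. v \<in> pverts G \<Longrightarrow> \<delta> \<le> out_degree G v"
    and girth: "\<And>c. graph_cycle G c \<Longrightarrow> 2 * k + 1 < length c" and e: "(x, y) \<in> parcs G"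
  shows "2 * (\<Sum>l<Suc k. (\<delta> - 1) ^ l) \<le> card (walk_ball x k \<union> walk_ball y k)"
proof -
  define A where "A = {(x, y), (y, x)}"
  let ?P = "nb_walks A (Suc k)"
  have sub: "A \<subseteq> parcs G" using e arcs_symmetric by (auto simp: A_def)
  have P: "nonbacktracking (tl p)" "length (tl p) \<le> k" "awalk (snd (hd p)) (tl p) (snd (last p))"
    "p = hd p # tl p" if "p \<in> ?P" for p
    using nb_walksD[OF that] by (cases p; auto simp: awalk_Cons_iff awalk_Nil_iff)+
  \<comment> \<open>With a common first arc, the tails start at the same vertex and have total
    length at most \<open>2 * k\<close>.\<close>
  have same: "p = q" if "p \<in> ?P" "q \<in> ?P" "snd (last p) = snd (last q)" "hd p = hd q" for p q
  proof -
    have "tl p = tl q"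
    proof (rule nonbacktracking_unique[of "tl p" "tl q" "snd (hd p)"])
      show "length (tl p) + length (tl q) < length c" if "graph_cycle G c" for c
        using girth[OF that] P(2)[OF \<open>p \<in> ?P\<close>] P(2)[OF \<open>q \<in> ?P\<close>] by simp
      show "awalk (snd (hd p)) (tl p) (snd (last p))" "awalk (snd (hd p)) (tl q) (snd (last p))"
        using P(3)[OF that(1)] P(3)[OF that(2)] that by simp_all
    qed (use P(1) that in auto)
    then show ?thesis using P(4)[OF that(1)] P(4)[OF that(2)] that(4) by metis
  qed
  \<comment> \<open>Two walks with opposite first arcs: dropping the first arc of one of them
    makes both start at the same vertex, with total length at most \<open>2 * k + 1\<close>.\<close>
  have opposite: False
    if "p \<in> ?P" "q \<in> ?P" "snd (last p) = snd (last q)" "fst (hd p) = snd (hd q)"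
      "snd (hd p) = fst (hd q)" for p q
  proof -
    have "p = tl q"
    proof (rule nonbacktracking_unique[of p "tl q" "fst (hd p)"])
      show "length p + length (tl q) < length c" if "graph_cycle G c" for c
        using girth[OF that] nb_walksD(3)[OF \<open>p \<in> ?P\<close>] P(2)[OF \<open>q \<in> ?P\<close>] by simp
      show "awalk (fst (hd p)) p (snd (last p))" "awalk (fst (hd p)) (tl q) (snd (last p))"
        using nb_walksD(5)[OF that(1)] P(3)[OF that(2)] that by simp_all
    qed (use nb_walksD(4)[OF that(1)] P(1)[OF that(2)] in auto)
    \<comment> \<open>Now \<open>q\<close> is \<open>hd q\<close> followed by \<open>p\<close>, and
      \<open>p\<close> begins with the reverse of \<open>hd q\<close>: a backtrack.\<close>
    then have "nonbacktracking (hd q # p)" "p \<noteq> []"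
      using nb_walksD(1,4)[OF that(2)] nb_walksD(1)[OF that(1)] by auto
    then show False using that by auto
  qed
  have "x \<noteq> y" using e no_loops' by blast
  then have "2 * (\<Sum>l<Suc k. (\<delta> - 1) ^ l) = card A * (\<Sum>l<Suc k. (\<delta> - 1) ^ l)"
    by (simp add: A_def)
  also have "\<dots> \<le> card ?P" by (rule card_nb_walks_ge[OF deg sub])
  also have "\<dots> = card ((\<lambda>p. snd (last p)) ` ?P)"
  proof (rule card_image[symmetric], rule inj_onI)
    fix p q assume *: "p \<in> ?P" "q \<in> ?P" "snd (last p) = snd (last q)"
    show "p = q"
      using same[OF *] opposite[OF *] nb_walksD(2)[OF *(1)] nb_walksD(2)[OF *(2)]
      by (auto simp: A_def)
  qed
  also have "\<dots> \<le> card (walk_ball x k \<union> walk_ball y k)"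
  proof (rule card_mono)
    show "(\<lambda>p. snd (last p)) ` ?P \<subseteq> walk_ball x k \<union> walk_ball y k"
    proof (rule image_subsetI)
      fix p assume p: "p \<in> ?P"
      have "snd (last p) \<in> walk_ball (snd (hd p)) k"
        using P(2,3)[OF p] unfolding walk_ball_def by blast
      then show "snd (last p) \<in> walk_ball x k \<union> walk_ball y k"
        using nb_walksD(2)[OF p] by (auto simp: A_def)
    qed
  qed (simp add: finite_walk_ball)
  finally show ?thesis .
qed

lemma min_degree_le: "v \<in> pverts G \<Longrightarrow> min_degree G \<le> out_degree G v"
  unfolding min_degree_def using pair_finite_verts by (intro Min_le) auto

section \<open>A cycle as a graph of its own\<close>

text \<open>Inside the list consecutive arcs match by \<open>awalk_nth\<close>; at the last index
  the match with the first arc comes from closedness.\<close>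

lemma graph_cycle_arc_nth:
  assumes "graph_cycle G p"
  shows "p ! nat (i mod int (length p)) = (cycle_vertex p i, cycle_vertex p (i + 1))"
proof -
  obtain u where u: "awalk u p u" and len: "3 \<le> length p"
    using assms by (auto simp: graph_cycle_altdef)
  let ?q = "int (length p)" and ?j = "nat (i mod int (length p))"
  have "0 < ?q" using len by linarith
  then have "0 \<le> i mod ?q" "i mod ?q < ?q" by simp_all
  then have j: "?j < length p" "int ?j = i mod ?q" by linarith+
  have "snd (p ! ?j) = cycle_vertex p (i + 1)"
  proof (cases "Suc ?j < length p")
    case True
    have "(i + 1) mod ?q = (i mod ?q + 1) mod ?q" by (simp add: mod_simps)
    also have "\<dots> = i mod ?q + 1" using True len j by (intro mod_pos_pos_trivial) linarith+
    finally have "nat ((i + 1) mod ?q) = Suc ?j" using j by linarith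
    then show ?thesis using awalk_nth[OF u True] by (simp add: cycle_vertex_def)
  next
    case False
    then have eq: "i mod ?q = ?q - 1" "?j = length p - 1" using j by linarith+
    have "(i + 1) mod ?q = (i mod ?q + 1) mod ?q" by (simp add: mod_simps)
    then have "(i + 1) mod ?q = 0" using eq by simp
    moreover have "p \<noteq> []" using len by auto
    moreover from this have "snd (last p) = fst (hd p)"
      using u awlast_eq[of p u] by (cases p) (auto simp: awalk_Cons_iff elim!: awalkE')
    ultimately show ?thesis using eq by (simp add: cycle_vertex_def last_conv_nth hd_conv_nth)
  qed
  then show ?thesis by (simp add: cycle_vertex_def prod_eq_iff)
qed

lemma set_graph_cycle:
  assumes "graph_cycle G p"
  shows "set p = range (\<lambda>i. (cycle_vertex p i, cycle_vertex p (i + 1)))"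
proof -
  have len: "length p > 0" using assms by (auto simp: graph_cycle_def)
  have "\<exists>i. e = (cycle_vertex p i, cycle_vertex p (i + 1))" if e: "e \<in> set p" for e
  proof -
    obtain j where "j < length p" "e = p ! j" using e by (auto simp: in_set_conv_nth)
    then show ?thesis using graph_cycle_arc_nth[OF assms, of "int j"] by auto
  qed
  moreover have "(cycle_vertex p i, cycle_vertex p (i + 1)) \<in> set p" for i
    using len by (subst graph_cycle_arc_nth[OF assms, symmetric]) (auto simp: nat_less_iff)
  ultimately show ?thesis by blast
qed

lemma cycle_vertex_eq_iff:
  assumes "graph_cycle G p"
  shows "cycle_vertex p i = cycle_vertex p j \<longleftrightarrow> int (length p) dvd i - j"
proof
  let ?q = "int (length p)"
  have len: "length p > 0" and dist: "distinct (map snd p)"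
    using assms by (auto simp: graph_cycle_altdef)
  assume eq: "cycle_vertex p i = cycle_vertex p j"
  \<comment> \<open>Distinctness is known for heads while \<open>cycle_vertex\<close> reads tails;
    vertex \<open>i\<close> is the head of arc \<open>i - 1\<close>.\<close>
  have snd_nth: "map snd p ! nat ((i - 1) mod ?q) = cycle_vertex p i" for i
    using len graph_cycle_arc_nth[OF assms, of "i - 1"] by (simp add: nat_less_iff)
  have "nat ((i - 1) mod ?q) = nat ((j - 1) mod ?q)"
    using len snd_nth[of i] snd_nth[of j] eq
    by (subst nth_eq_iff_index_eq[OF dist, symmetric]) (auto simp: nat_less_iff)
  then have "(i - 1) mod ?q = (j - 1) mod ?q" using len by (simp add: nat_eq_iff)
  then show "?q dvd i - j" by (simp add: mod_eq_dvd_iff)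
next
  assume "int (length p) dvd i - j"
  then show "cycle_vertex p i = cycle_vertex p j"
    by (intro cycle_vertex_cong) (simp add: mod_eq_dvd_iff)
qed

lemma pverts_walk_graph:
  assumes "graph_cycle G p"
  shows "pverts (walk_graph p) = range (cycle_vertex p)"
proof -
  have "cycle_vertex p (i + 1) \<in> range (cycle_vertex p)" for i by simp
  then show ?thesis by (auto simp: walk_graph_def set_graph_cycle[OF assms] image_image)
qed

lemma walk_graph_awalk_imp_awalk:
  assumes "graph_cycle G p" "pre_digraph.awalk (walk_graph p) x r y"
  shows "awalk x r y"
proof -
  interpret W: pair_wf_digraph "walk_graph p" by (rule pair_wf_digraph_walk_graph)
  have "set p \<subseteq> parcs G" using assms(1) by (auto simp: graph_cycle_altdef)
  then have "parcs (walk_graph p) \<subseteq> parcs G" "pverts (walk_graph p) \<subseteq> pverts G"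
    using arcs_symmetric in_arcsD1 in_arcsD2 by (auto simp: walk_graph_def)
  then show ?thesis using assms(2) unfolding W.awalk_def awalk_def by auto
qed

text \<open>Every arc of \<open>walk_graph p\<close> changes the index by 1 or -1, so index
  differences bound walk lengths from below.\<close>

lemma walk_graph_awalk_shift:
  assumes cyc: "graph_cycle G p" and "pre_digraph.awalk (walk_graph p) (cycle_vertex p i) r y"
  shows "\<exists>t. \<bar>t\<bar> \<le> int (length r) \<and> y = cycle_vertex p (i + t)"
proof -
  interpret W: pair_wf_digraph "walk_graph p" by (rule pair_wf_digraph_walk_graph)
  show ?thesis using assms(2)
  proof (induction r arbitrary: i)
    case Nil
    then show ?case by (intro exI[of _ 0]) (auto simp: W.awalk_Nil_iff)
  next
    case (Cons e r)
    then have e: "e \<in> parcs (walk_graph p)" "fst e = cycle_vertex p i"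
      and r: "W.awalk (snd e) r y" by (auto simp: W.awalk_Cons_iff)
    have "\<exists>s. \<bar>s\<bar> = 1 \<and> snd e = cycle_vertex p (i + s)"
    proof (cases "e \<in> set p")
      case True
      then obtain j where j: "e = (cycle_vertex p j, cycle_vertex p (j + 1))"
        using set_graph_cycle[OF cyc] by auto
      then have "cycle_vertex p (j + 1) = cycle_vertex p (i + 1)"
        using e(2) by (simp add: cycle_vertex_eq_iff[OF cyc])
      then show ?thesis using j by (intro exI[of _ 1]) simp
    next
      case False
      then obtain j where j: "e = (cycle_vertex p (j + 1), cycle_vertex p j)"
        using e(1) set_graph_cycle[OF cyc] by (auto simp: walk_graph_def)
      then have "cycle_vertex p j = cycle_vertex p (i + - 1)"
        using e(2) by (simp add: cycle_vertex_eq_iff[OF cyc] algebra_simps)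
      then show ?thesis using j by (intro exI[of _ "- 1"]) simp
    qed
    then obtain s where s: "\<bar>s\<bar> = 1" "snd e = cycle_vertex p (i + s)" by auto
    obtain t where "\<bar>t\<bar> \<le> int (length r)" "y = cycle_vertex p (i + s + t)"
      using Cons.IH[of "i + s"] r s(2) by auto
    then show ?case using s(1) by (intro exI[of _ "s + t"]) (auto simp: add.assoc)
  qed
qed

text \<open>\<open>s\<close> is the direction of travel; both directions exist because
  \<open>walk_graph p\<close> contains the reversed arcs.\<close>

lemma walk_graph_awalk_arc:
  assumes cyc: "graph_cycle G p" and s: "s = 1 \<or> s = - 1"
  shows "\<exists>r. pre_digraph.awalk (walk_graph p) (cycle_vertex p i) r (cycle_vertex p (i + s * int t))
           \<and> length r = t"
proof -
  interpret W: pair_wf_digraph "walk_graph p" by (rule pair_wf_digraph_walk_graph)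
  have arc: "(cycle_vertex p i, cycle_vertex p (i + s)) \<in> parcs (walk_graph p)" for i
  proof -
    have "(cycle_vertex p (i - 1), cycle_vertex p (i - 1 + 1)) \<in> set p"
      "(cycle_vertex p i, cycle_vertex p (i + 1)) \<in> set p"
      using set_graph_cycle[OF cyc] by blast+
    then show ?thesis using s by (auto simp: walk_graph_def)
  qed
  show ?thesis
  proof (induction t arbitrary: i)
    case 0
    show ?case using pverts_walk_graph[OF cyc] by (auto simp: W.awalk_Nil_iff)
  next
    case (Suc t)
    obtain r where r: "W.awalk (cycle_vertex p (i + s)) r (cycle_vertex p (i + s + s * int t))"
      "length r = t" using Suc by blast
    have "i + s + s * int t = i + s * int (Suc t)" by (simp add: algebra_simps)
    with r arc[of i] show ?case
      by (intro exI[of _ "(cycle_vertex p i, cycle_vertex p (i + s)) # r"])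
         (simp add: W.awalk_Cons_iff)
  qed
qed

text \<open>The two ways around the cycle have total length \<open>length p\<close>; the shorter one
  is taken.\<close>

lemma walk_graph_short_awalk:
  assumes cyc: "graph_cycle G p"
  shows "\<exists>r. pre_digraph.awalk (walk_graph p) (cycle_vertex p i) r (cycle_vertex p j)
           \<and> 2 * length r \<le> length p"
proof -
  let ?q = "int (length p)"
  define t where "t = (j - i) mod ?q"
  have len: "0 < ?q" using cyc by (auto simp: graph_cycle_def)
  have t: "0 \<le> t" "t < ?q" "?q dvd (j - i) - t"
    using len by (simp_all add: t_def mod_eq_dvd_iff[symmetric])
  show ?thesis
  proof (cases "2 * t \<le> ?q")
    case True
    have "cycle_vertex p (i + 1 * int (nat t)) = cycle_vertex p j"
      unfolding cycle_vertex_eq_iff[OF cyc]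
      using t by (subst dvd_diff_commute) (simp add: algebra_simps)
    with walk_graph_awalk_arc[OF cyc, of 1 i "nat t"] True t show ?thesis by auto
  next
    case False
    have "?q dvd ((j - i) - t) + ?q" using t(3) by simp
    then have "cycle_vertex p (i + - 1 * int (nat (?q - t))) = cycle_vertex p j"
      unfolding cycle_vertex_eq_iff[OF cyc]
      using t by (subst dvd_diff_commute) (simp add: algebra_simps)
    moreover obtain r where "length r = nat (?q - t)"
      "pre_digraph.awalk (walk_graph p) (cycle_vertex p i) r
         (cycle_vertex p (i + - 1 * int (nat (?q - t))))"
      using walk_graph_awalk_arc[OF cyc, of "- 1" i "nat (?q - t)"] by blast
    ultimately show ?thesis using False t by (intro exI[of _ r]) auto
  qed
qed

section \<open>Isometric cycles and the equator\<close>

text \<open>Suppose a walk in \<open>G\<close> beats the distance along the cycle. Once reduced, it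
  and a reduced walk along at most half of the cycle have total length below
  \<open>length p\<close>, so they coincide, although their lengths differ.\<close>

lemma shortest_cycle_isometric:
  assumes cyc: "graph_cycle G p" and shortest: "\<And>c. graph_cycle G c \<Longrightarrow> length p \<le> length c"
  shows "isometric_cycle G p"
  unfolding isometric_cycle_def
proof (intro conjI ballI)
  interpret W: pair_wf_digraph "walk_graph p" by (rule pair_wf_digraph_walk_graph)
  fix x y assume "x \<in> pverts (walk_graph p)" "y \<in> pverts (walk_graph p)"
  then obtain i j where xy: "x = cycle_vertex p i" "y = cycle_vertex p j"
    using pverts_walk_graph[OF cyc] by auto
  show "graph_dist (walk_graph p) x y = graph_dist G x y"
  proof (rule antisym)
    show "graph_dist G x y \<le> graph_dist (walk_graph p) x y"
      unfolding graph_dist_eq W.graph_dist_eq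
      using walk_graph_awalk_imp_awalk[OF cyc] by (intro INF_superset_mono) auto
    show "graph_dist (walk_graph p) x y \<le> graph_dist G x y"
    proof (rule ccontr)
      assume "\<not> ?thesis"
      then obtain r where r: "awalk x r y" "ereal (real (length r)) < graph_dist (walk_graph p) x y"
        unfolding graph_dist_eq not_le INF_less_iff by auto
      obtain r' where r': "awalk x r' y" "nonbacktracking r'" "length r' \<le> length r"
        using awalk_imp_nonbacktracking[OF r(1)] by auto
      obtain s where "W.awalk x s y" "2 * length s \<le> length p"
        using walk_graph_short_awalk[OF cyc] xy by blast
      then obtain s' where s': "W.awalk x s' y" "nonbacktracking s'" "2 * length s' \<le> length p"
        using W.awalk_imp_nonbacktracking[of x s y] by force
      have "graph_dist (walk_graph p) x y \<le> ereal (real (length s'))"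
        using s'(1) W.graph_dist_le_iff by blast
      with r(2) have "ereal (real (length r)) < ereal (real (length s'))" by (rule less_le_trans)
      with r' have less: "length r' < length s'" by simp
      have "r' = s'"
      proof (rule nonbacktracking_unique)
        show "length r' + length s' < length c" if "graph_cycle G c" for c
          using shortest[OF that] less s'(3) by linarith
      qed (use r' s' walk_graph_awalk_imp_awalk[OF cyc] in auto)
      then show False using less by simp
    qed
  qed
qed (rule cyc)

text \<open>Isometry replaces \<open>r\<close> by a walk inside the cycle that is no longer, and
  such a walk moves the index by at most its length.\<close>

lemma isometric_cycle_shift:
  assumes iso: "isometric_cycle G p" and r: "awalk (cycle_vertex p i) r (cycle_vertex p j)"
  shows "\<exists>t. \<bar>t\<bar> \<le> int (length r) \<and> int (length p) dvd j - (i + t)"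
proof -
  interpret W: pair_wf_digraph "walk_graph p" by (rule pair_wf_digraph_walk_graph)
  have cyc: "graph_cycle G p" using iso by (simp add: isometric_cycle_def)
  have "graph_dist (walk_graph p) (cycle_vertex p i) (cycle_vertex p j)
      = graph_dist G (cycle_vertex p i) (cycle_vertex p j)"
    using iso pverts_walk_graph[OF cyc] by (auto simp: isometric_cycle_def)
  also have "\<dots> \<le> ereal (real (length r))" using r graph_dist_le_iff by blast
  finally obtain r' where r': "W.awalk (cycle_vertex p i) r' (cycle_vertex p j)"
    "length r' \<le> length r" using W.graph_dist_le_iff by auto
  obtain t where "\<bar>t\<bar> \<le> int (length r')" "cycle_vertex p j = cycle_vertex p (i + t)"
    using walk_graph_awalk_shift[OF cyc r'(1)] by blast
  then show ?thesis using r'(2) by (intro exI[of _ t]) (auto simp: cycle_vertex_eq_iff[OF cyc])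
qed

text \<open>\<open>Max\<close> is attained on a finite nonempty set: a shortest cycle is isometric,
  and no cycle has more arcs than \<open>G\<close> has vertices.\<close>

lemma equator_attained:
  assumes "girth G = enat g"
  shows "\<exists>p. isometric_cycle G p \<and> length p = equator G"
proof -
  let ?L = "{length p | p. isometric_cycle G p}"
  obtain p where "graph_cycle G p" "length p = g" using girth_eq_enatD(1)[OF assms] by auto
  then have "isometric_cycle G p"
    using girth_eq_enatD(2)[OF assms] by (intro shortest_cycle_isometric) auto
  then have nonempty: "?L \<noteq> {}" by auto
  have "?L \<subseteq> {..card (pverts G)}"
  proof
    fix m assume "m \<in> ?L"
    then obtain p where "isometric_cycle G p" and m: "m = length p" by blast
    then have p: "distinct (map snd p)" "set p \<subseteq> parcs G"
      by (auto simp: isometric_cycle_def graph_cycle_altdef)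
    then have "length p = card (snd ` set p)" using distinct_card[of "map snd p"] by simp
    also have "\<dots> \<le> card (pverts G)"
    proof (rule card_mono[OF pair_finite_verts], rule image_subsetI)
      show "snd e \<in> pverts G" if "e \<in> set p" for e
        using that p(2) by (intro arc_snd_in_verts) blast
    qed
    finally show "m \<in> {..card (pverts G)}" by (simp add: m)
  qed
  then have "finite ?L" by (rule finite_subset) simp
  from Max_in[OF this nonempty] have "equator G \<in> ?L" by (simp only: equator_def)
  then show ?thesis by auto
qed

section \<open>Counting incidences between balls and vertices\<close>

text \<open>Two such indices are joined by a walk of length at most \<open>2 * k\<close> through
  \<open>v\<close>, so \<open>pairwise_close_imp_window\<close> applies with
  \<open>d = 2 * k\<close>.\<close>

lemma walk_ball_indices_window:
  assumes iso: "isometric_cycle G p" and "6 * k < length p"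
  shows "\<exists>a. \<forall>i. v \<in> walk_ball (cycle_vertex p i) k \<longrightarrow>
    (\<exists>s\<in>{0..2 * int k}. int (length p) dvd i - (a + s))"
proof -
  have cyc: "graph_cycle G p" using iso by (simp add: isometric_cycle_def)
  let ?S = "{i. v \<in> walk_ball (cycle_vertex p i) k}"
  have "\<exists>a. \<forall>i\<in>?S. \<exists>s\<in>{0..2 * int k}. int (length p) dvd i - (a + s)"
  proof (rule pairwise_close_imp_window)
    fix i j assume "i \<in> ?S" "j \<in> ?S"
    then obtain r s where rs: "awalk (cycle_vertex p i) r v" "length r \<le> k"
      "awalk (cycle_vertex p j) s v" "length s \<le> k" by (auto simp: walk_ball_def)
    have "awalk (cycle_vertex p i) (r @ rev_path s) (cycle_vertex p j)"
      by (rule awalk_appendI[OF rs(1)]) (simp add: rs(3))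
    from isometric_cycle_shift[OF iso this] rs(2,4)
    show "\<exists>t. \<bar>t\<bar> \<le> 2 * int k \<and> int (length p) dvd j - (i + t)" by force
  next
    fix i j assume "i \<in> ?S" "int (length p) dvd j - i"
    then show "j \<in> ?S" using cycle_vertex_eq_iff[OF cyc, of j i] by simp
  qed (use assms(2) in simp)
  then show ?thesis by simp
qed

lemma equator_moore_bound:
  assumes girth: "girth G = enat g" and "3 \<le> g" and long: "6 * half_girth g < equator G"
  shows "equator G * moore_bound (min_degree G) g \<le> card (pverts G) * g"
proof -
  define k \<delta> where "k = half_girth g" and "\<delta> = min_degree G"
  obtain p where iso: "isometric_cycle G p" and len: "length p = equator G"
    using equator_attained[OF girth] by auto
  then have cyc: "graph_cycle G p" by (simp add: isometric_cycle_def)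
  let ?c = "cycle_vertex p" and ?I = "{0..<int (length p)}"
  have arc: "(?c i, ?c (i + 1)) \<in> parcs G" for i
    using cyc set_graph_cycle[OF cyc] by (auto simp: graph_cycle_altdef)
  have deg: "\<delta> \<le> out_degree G v" if "v \<in> pverts G" for v
    using min_degree_le[OF that] by (simp add: \<delta>_def)
  have long': "6 * k < length p" using long len by (simp add: k_def)
  have "card ?I * moore_bound \<delta> g \<le> card (pverts G) * g"
  proof (cases "odd g")
    case True
    have g: "g = 2 * k + 1" using half_girth_cases(1)[of g] True \<open>3 \<le> g\<close> by (simp add: k_def)
    show ?thesis
    proof (rule double_counting_le[where B = "\<lambda>i. walk_ball (?c i) k"])
      fix i
      have "2 * k < length c" if "graph_cycle G c" for c
        using girth_eq_enatD(2)[OF girth that] g by simp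
      from card_walk_ball_ge[OF deg this in_arcsD1[OF arc]]
      show "moore_bound \<delta> g \<le> card (walk_ball (?c i) k)"
        using True by (simp add: moore_bound_def k_def sum_distrib_left)
    next
      fix v
      obtain a where a: "\<And>i. v \<in> walk_ball (?c i) k \<Longrightarrow>
          \<exists>s\<in>{0..2 * int k}. int (length p) dvd i - (a + s)"
        using walk_ball_indices_window[OF iso long'] by blast
      \<comment> \<open>The offsets from 0 to \<open>2 * k\<close> number exactly
        \<open>g\<close>.\<close>
      have "card {i \<in> ?I. v \<in> walk_ball (?c i) k} \<le> nat (2 * int k - 0 + 1)"
        using a by (intro card_window_le) auto
      then show "card {i \<in> ?I. v \<in> walk_ball (?c i) k} \<le> g" by (simp add: g)
    qed (use walk_ball_subset pair_finite_verts in auto)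
  next
    case False
    have g: "g = 2 * k + 2" using half_girth_cases(2)[of g] False \<open>3 \<le> g\<close> by (simp add: k_def)
    show ?thesis
    proof (rule double_counting_le[where B = "\<lambda>i. walk_ball (?c i) k \<union> walk_ball (?c (i + 1)) k"])
      fix i
      have "2 * k + 1 < length c" if "graph_cycle G c" for c
        using girth_eq_enatD(2)[OF girth that] g by simp
      note card_edge_ball_ge[OF deg this arc]
      \<comment> \<open>The separate summand 2 of the even case is the term for
        \<open>l = 0\<close>.\<close>
      moreover have "moore_bound \<delta> g = 2 * (\<Sum>l<Suc k. (\<delta> - 1) ^ l)"
        using False
        by (simp add: moore_bound_def k_def sum_distrib_left lessThan_Suc_atMost
            atMost_atLeast0 sum.atLeast_Suc_atMost)
      ultimately show "moore_bound \<delta> g \<le> card (walk_ball (?c i) k \<union> walk_ball (?c (i + 1)) k)"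
        by simp
    next
      fix v
      obtain a where a: "\<And>i. v \<in> walk_ball (?c i) k \<Longrightarrow>
          \<exists>s\<in>{0..2 * int k}. int (length p) dvd i - (a + s)"
        using walk_ball_indices_window[OF iso long'] by blast
      \<comment> \<open>Reaching \<open>v\<close> from the second end \<open>i + 1\<close> of the
        edge lowers the offset of \<open>i\<close> by one, so the window gains -1 and has
        \<open>2 * k + 2 = g\<close> offsets.\<close>
      have "\<exists>s\<in>{- 1..2 * int k}. int (length p) dvd i - (a + s)"
        if "v \<in> walk_ball (?c i) k \<union> walk_ball (?c (i + 1)) k" for i
        using that
      proof
        assume "v \<in> walk_ball (?c i) k"
        from a[OF this] show ?thesis by force
      next
        assume "v \<in> walk_ball (?c (i + 1)) k"
        from a[OF this] obtain s where "s \<in> {0..2 * int k}"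
          "int (length p) dvd i + 1 - (a + s)" by blast
        then show ?thesis by (intro bexI[of _ "s - 1"]) (auto simp: algebra_simps)
      qed
      then have "card {i \<in> ?I. v \<in> walk_ball (?c i) k \<union> walk_ball (?c (i + 1)) k}
          \<le> nat (2 * int k - (- 1) + 1)"
        by (intro card_window_le) auto
      then show "card {i \<in> ?I. v \<in> walk_ball (?c i) k \<union> walk_ball (?c (i + 1)) k} \<le> g"
        by (simp add: g nat_add_distrib)
    qed (use walk_ball_subset pair_finite_verts in auto)
  qed
  then show ?thesis by (simp add: len \<delta>_def)
qed

end

theorem theorem8:
  fixes G :: "'a pair_pre_digraph" and n g \<delta> q k :: nat
  assumes "pair_graph G"
    and "n = card (pverts G)"
    and "girth G = enat g" and "3 \<le> g"
    and "\<delta> = min_degree G" and "2 \<le> \<delta>"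
    and "q = equator G"
    and "k = half_girth g"
    and "q > 6 * k + 3"
  shows "real n \<ge> real q / real g * real (moore_bound \<delta> g)"
proof -
  interpret pair_graph G by fact
  have "q * moore_bound \<delta> g \<le> n * g"
    using equator_moore_bound[OF assms(3,4)] assms by simp
  then have "real q * real (moore_bound \<delta> g) \<le> real n * real g"
    by (simp flip: of_nat_mult)
  then show ?thesis using \<open>3 \<le> g\<close> by (simp add: field_simps)
qed

end
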